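(* Let $G$ be a finite simple undirected graph, let $D[G]$ be its double graph, and let $G\otimes K_2$ be the Kronecker product of $G$ with the complete graph $K_2$. Then $G\otimes K_2$ and $D[G]$ are non-cospectral equienergetic graphs.
   Context: The $A$-spectrum of a graph is the multiset of eigenvalues $\lambda_1,\dots,\lambda_n$ of its adjacency matrix, and its energy is $E(G)=\sum_{i=1}^n|\lambda_i|$. Two graphs of the same order are equienergetic if they have equal energy; they are non-cospectral if their $A$-spectra differ. The double graph $D[G]$ is obtained by taking two copies of $G$ and joining each vertex in one copy with the neighbours of the corresponding vertex in the other copy; i.e. it has vertex set $V(G)\times\{1,2\}$ with $(u,a)$ adjacent to $(v,b)$ iff $u$ is adjacent to $v$ in $G$. The Kronecker product (conjunction) $G_1\otimes G_2$ has vertex set $V(G_1)\times V(G_2)$, with $(u_1,v_1)$ adjacent to $(u_2,v_2)$ iff $u_1u_2$ is an edge of $G_1$ and $v_1v_2$ is an edge of $G_2$.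
   Formalization: Non-cospectrality is claimed only when G has at least one edge, since for an edgeless G both graphs are edgeless of the same order and hence cospectral; equal energy is proved for every G. *)

theory Defs
  imports
    Complex_Main
    "HOL-Computational_Algebra.Computational_Algebra"
    "Graph_Theory.Graph_Theory"
    "Jordan_Normal_Form.Char_Poly"
begin

text \<open>
  A finite simple undirected graph is a \<open>pair_graph\<close>: a finite vertex set together with a
  symmetric, irreflexive set of arcs, each edge \<open>uv\<close> being the pair of arcs \<open>(u,v)\<close>, \<open>(v,u)\<close>.
\<close>

definition double_graph :: "'a pair_pre_digraph \<Rightarrow> ('a \<times> nat) pair_pre_digraph" where
  "double_graph G =
     \<lparr> pverts = pverts G \<times> {1, 2},
       parcs = {((u, a), (v, b)) | u a v b. (u, v) \<in> parcs G \<and> a \<in> {1, 2} \<and> b \<in> {1, 2}} \<rparr>"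

definition kronecker_product ::
    "'a pair_pre_digraph \<Rightarrow> 'b pair_pre_digraph \<Rightarrow> ('a \<times> 'b) pair_pre_digraph" where
  "kronecker_product G H =
     \<lparr> pverts = pverts G \<times> pverts H,
       parcs = {((u1, v1), (u2, v2)) | u1 v1 u2 v2. (u1, u2) \<in> parcs G \<and> (v1, v2) \<in> parcs H} \<rparr>"

definition vertex_enumeration :: "'a pair_pre_digraph \<Rightarrow> 'a list \<Rightarrow> bool" where
  "vertex_enumeration G vs \<longleftrightarrow> distinct vs \<and> set vs = pverts G"

definition adjacency_matrix :: "'a pair_pre_digraph \<Rightarrow> 'a list \<Rightarrow> complex mat" where
  "adjacency_matrix G vs =
     mat (length vs) (length vs) (\<lambda>(i, j). if (vs ! i, vs ! j) \<in> parcs G then 1 else 0)"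

text \<open>
  The eigenvalues with multiplicity are the roots of the characteristic polynomial. They are taken
  over the complex numbers, so that no eigenvalue can be lost (they are in fact all real). The
  chosen enumeration is irrelevant, see \<open>A_spectrum_eq\<close> below.
\<close>

definition A_spectrum :: "'a pair_pre_digraph \<Rightarrow> complex multiset" where
  "A_spectrum G = proots (char_poly (adjacency_matrix G (SOME vs. vertex_enumeration G vs)))"

definition energy :: "'a pair_pre_digraph \<Rightarrow> real" where
  "energy G = (\<Sum>x\<in>#A_spectrum G. cmod x)"

definition equienergetic :: "'a pair_pre_digraph \<Rightarrow> 'b pair_pre_digraph \<Rightarrow> bool" where
  "equienergetic G H \<longleftrightarrow> card (pverts G) = card (pverts H) \<and> energy G = energy H"

definition non_cospectral :: "'a pair_pre_digraph \<Rightarrow> 'b pair_pre_digraph \<Rightarrow> bool" where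
  "non_cospectral G H \<longleftrightarrow> A_spectrum G \<noteq> A_spectrum H"

lemma pair_graph_double_graph:
  assumes "pair_graph G" shows "pair_graph (double_graph G)"
proof -
  interpret pair_graph G by fact
  have fv: "finite (pverts (double_graph G))"
    by (simp add: double_graph_def pair_finite_verts)
  have sub: "parcs (double_graph G) \<subseteq> pverts (double_graph G) \<times> pverts (double_graph G)"
    by (auto simp: double_graph_def dest: in_arcsD1 in_arcsD2)
  have fa: "finite (parcs (double_graph G))"
    using finite_subset[OF sub] fv by blast
  have sym: "symmetric (with_proj (double_graph G))"
    using sym_arcs by (auto simp: double_graph_def symmetric_def sym_def)
  have loopfree: "fst e \<noteq> snd e" if "e \<in> parcs (double_graph G)" for e
    using that pair_no_loops by (fastforce simp: double_graph_def)
  show ?thesis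
    by unfold_locales (use sub fv fa sym loopfree in \<open>auto simp: mem_Times_iff\<close>)
qed

lemma pair_graph_kronecker_product:
  assumes "pair_graph G" "pair_graph H" shows "pair_graph (kronecker_product G H)"
proof -
  interpret G: pair_graph G by fact
  interpret H: pair_graph H by fact
  let ?P = "kronecker_product G H"
  have fv: "finite (pverts ?P)"
    by (simp add: kronecker_product_def G.pair_finite_verts H.pair_finite_verts)
  have sub: "parcs ?P \<subseteq> pverts ?P \<times> pverts ?P"
    by (auto simp: kronecker_product_def
        dest: G.in_arcsD1 G.in_arcsD2 H.in_arcsD1 H.in_arcsD2)
  have fa: "finite (parcs ?P)"
    using finite_subset[OF sub] fv by blast
  have sym: "symmetric (with_proj ?P)"
    using G.sym_arcs H.sym_arcs by (auto simp: kronecker_product_def symmetric_def sym_def)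
  have loopfree: "fst e \<noteq> snd e" if "e \<in> parcs ?P" for e
    using that G.pair_no_loops by (fastforce simp: kronecker_product_def)
  show ?thesis
    by unfold_locales (use sub fv fa sym loopfree in \<open>auto simp: mem_Times_iff\<close>)
qed

lemma char_poly_adjacency_matrix_cong:
  assumes "vertex_enumeration G vs" "vertex_enumeration G ws"
  shows "char_poly (adjacency_matrix G vs) = char_poly (adjacency_matrix G ws)"
proof -
  define n where "n = length vs"
  have dv: "distinct vs" "distinct ws" "set vs = set ws"
    using assms by (auto simp: vertex_enumeration_def)
  have lw: "length ws = n"
    using dv by (metis distinct_card n_def)
  define P :: "complex mat" where "P = mat n n (\<lambda>(i, j). if vs ! i = ws ! j then 1 else 0)"
  define Q :: "complex mat" where "Q = mat n n (\<lambda>(i, j). if ws ! i = vs ! j then 1 else 0)"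
  have key: "\<exists>k<n. \<forall>j<n. (xs ! i = ys ! j) = (j = k)"
    if "distinct xs" "distinct ys" "set xs = set ys" "length xs = n" "length ys = n" "i < n"
    for xs ys :: "'a list" and i
    using that by (metis in_set_conv_nth nth_eq_iff_index_eq)
  have one: "P * Q = 1\<^sub>m n" if h: "distinct xs" "distinct ys" "set xs = set ys" "length xs = n"
    "length ys = n" "P = mat n n (\<lambda>(i, j). if xs ! i = ys ! j then 1 else 0)"
    "Q = mat n n (\<lambda>(i, j). if ys ! i = xs ! j then 1 else 0)" for xs ys :: "'a list"
    and P Q :: "complex mat"
  proof (rule eq_matI)
    fix i j assume "i < dim_row (1\<^sub>m n :: complex mat)" "j < dim_col (1\<^sub>m n :: complex mat)"
    hence ij: "i < n" "j < n" by auto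
    obtain k where k: "k < n" "\<forall>l<n. (xs ! i = ys ! l) = (l = k)"
      using key[OF h(1-5) ij(1)] by blast
    have "(P * Q) $$ (i, j) = (\<Sum>l\<in>{0..<n}. P $$ (i, l) * Q $$ (l, j))"
      using ij h(6,7) by (simp add: scalar_prod_def)
    also have "\<dots> = (\<Sum>l\<in>{0..<n}. if l = k then (if ys ! k = xs ! j then 1 else 0) else 0)"
      using ij k h(6,7) by (intro sum.cong) auto
    also have "\<dots> = (if ys ! k = xs ! j then 1 else 0)" using k by simp
    also have "ys ! k = xs ! i" using k(1) k(2)[rule_format, of k] by auto
    finally show "(P * Q) $$ (i, j) = 1\<^sub>m n $$ (i, j)"
      using ij h(1,4) by (simp add: nth_eq_iff_index_eq)
  qed (use h(6,7) in auto)
  have PQ: "P * Q = 1\<^sub>m n" "Q * P = 1\<^sub>m n"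
    by (rule one[OF dv n_def[symmetric] lw P_def Q_def])
       (rule one[OF dv(2,1) dv(3)[symmetric] lw n_def[symmetric] Q_def P_def])
  have carr: "P \<in> carrier_mat n n" "Q \<in> carrier_mat n n"
    "adjacency_matrix G vs \<in> carrier_mat n n" "adjacency_matrix G ws \<in> carrier_mat n n"
    by (auto simp: P_def Q_def adjacency_matrix_def n_def lw)
  have comm: "adjacency_matrix G vs * P = P * adjacency_matrix G ws"
  proof (rule eq_matI)
    fix i j assume "i < dim_row (P * adjacency_matrix G ws)" "j < dim_col (P * adjacency_matrix G ws)"
    hence ij: "i < n" "j < n" using carr by auto
    obtain k where k: "k < n" "\<forall>l<n. (vs ! i = ws ! l) = (l = k)"
      using key[OF dv _ lw ij(1)] n_def by metis
    obtain m where m: "m < n" "\<forall>l<n. (ws ! j = vs ! l) = (l = m)"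
      using key[OF dv(2,1) dv(3)[symmetric] lw _ ij(2)] n_def by metis
    have mm: "ws ! j = vs ! m" and kk: "vs ! i = ws ! k"
      using m(1) m(2)[rule_format, of m] k(1) k(2)[rule_format, of k] by blast+
    have "(adjacency_matrix G vs * P) $$ (i, j)
        = (\<Sum>l\<in>{0..<n}. adjacency_matrix G vs $$ (i, l) * P $$ (l, j))"
      using ij carr by (simp add: scalar_prod_def)
    also have "\<dots> = (\<Sum>l\<in>{0..<n}. if l = m then adjacency_matrix G vs $$ (i, m) else 0)"
      using ij m by (intro sum.cong) (auto simp: P_def eq_commute[of "vs ! _" "ws ! j"])
    also have "\<dots> = (if (vs ! i, ws ! j) \<in> parcs G then 1 else 0)"
      using m(1) mm ij by (simp add: adjacency_matrix_def n_def[symmetric])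
    finally have L: "(adjacency_matrix G vs * P) $$ (i, j)
        = (if (vs ! i, ws ! j) \<in> parcs G then 1 else 0)" .
    have "(P * adjacency_matrix G ws) $$ (i, j)
        = (\<Sum>l\<in>{0..<n}. P $$ (i, l) * adjacency_matrix G ws $$ (l, j))"
      using ij carr by (simp add: scalar_prod_def)
    also have "\<dots> = (\<Sum>l\<in>{0..<n}. if l = k then adjacency_matrix G ws $$ (k, j) else 0)"
      using ij k by (intro sum.cong) (auto simp: P_def)
    also have "\<dots> = (if (vs ! i, ws ! j) \<in> parcs G then 1 else 0)"
      using k(1) kk ij by (simp add: adjacency_matrix_def lw)
    finally show "(adjacency_matrix G vs * P) $$ (i, j) = (P * adjacency_matrix G ws) $$ (i, j)"
      using L by simp
  qed (use carr in auto)
  have "adjacency_matrix G vs = adjacency_matrix G vs * (P * Q)"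
    using carr PQ by simp
  also have "\<dots> = P * adjacency_matrix G ws * Q"
    using assoc_mult_mat[OF carr(3) carr(1) carr(2)] comm by simp
  finally have "similar_mat (adjacency_matrix G vs) (adjacency_matrix G ws)"
    using carr PQ by (intro similar_matI[of _ _ P Q n]) auto
  thus ?thesis by (rule char_poly_similar)
qed

lemma A_spectrum_eq:
  assumes "vertex_enumeration G vs"
  shows "A_spectrum G = proots (char_poly (adjacency_matrix G vs))"
proof -
  have "vertex_enumeration G (SOME vs. vertex_enumeration G vs)"
    using assms by (rule someI)
  thus ?thesis
    unfolding A_spectrum_def using char_poly_adjacency_matrix_cong[OF _ assms] by metis
qed

lemma size_A_spectrum:
  assumes "pair_graph G"
  shows "size (A_spectrum G) = card (pverts G)"
proof -
  interpret pair_graph G by fact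
  obtain vs where vs: "vertex_enumeration G vs"
    using finite_distinct_list[OF pair_finite_verts] by (auto simp: vertex_enumeration_def)
  hence len: "length vs = card (pverts G)"
    using distinct_card[of vs] by (simp add: vertex_enumeration_def)
  have "adjacency_matrix G vs \<in> carrier_mat (card (pverts G)) (card (pverts G))"
    by (simp add: adjacency_matrix_def len)
  from degree_monic_char_poly[OF this] show ?thesis
    by (simp add: A_spectrum_eq[OF vs] size_proots_complex)
qed

end

theory Submission
  imports Defs "Jordan_Normal_Form.Schur_Decomposition"
begin

text \<open>
  Let \<open>A\<close> be the adjacency matrix of \<open>G\<close>. Listing the two copies of \<open>V(G)\<close> one after the other,
  the double graph has the adjacency matrix with blocks \<open>A, A, A, A\<close>, and \<open>G \<otimes> K\<^sub>2\<close> the one with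
  blocks \<open>0, A, A, 0\<close>. Both have the symmetric shape \<open>S, T, T, S\<close>, and passing to the coordinates
  \<open>x + y\<close>, \<open>x - y\<close> makes such a matrix block diagonal with blocks \<open>S + T\<close> and \<open>S - T\<close>
  (\<open>char_poly_symmetric_blocks\<close>). So if \<open>G\<close> has the eigenvalues \<open>e\<close>, then \<open>D[G]\<close> has the
  eigenvalues \<open>2e\<close> and \<open>0\<close>, while \<open>G \<otimes> K\<^sub>2\<close> has \<open>e\<close> and \<open>-e\<close> (\<open>A_spectrum_two_layers\<close>). In both
  cases the energy is twice that of \<open>G\<close>.

  If the two spectra were equal, every \<open>2e\<close> would again be an eigenvalue of \<open>G\<close> up to sign. Applied
  to an \<open>e\<close> of largest modulus, this forces every eigenvalue of \<open>G\<close> to vanish. But the squares of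
  the eigenvalues add up to the trace of \<open>A\<^sup>2\<close>, which is the number of arcs of \<open>G\<close>
  (\<open>sum_squares_A_spectrum\<close>); hence an edge rules this out. Without an edge both
  spectra consist of zeros only, which is why non-cospectrality is claimed just for \<open>G\<close> with an edge.
\<close>

section \<open>Eigenvalues of scaled, squared and block matrices\<close>

lemma triangularization_complex:
  fixes A :: "complex mat"
  assumes "A \<in> carrier_mat n n"
  obtains B where "B \<in> carrier_mat n n" "upper_triangular B" "similar_mat A B"
  using char_poly_factorized[OF assms] schur_decomposition_exists[OF assms] by metis

lemma proots_char_poly_upper_triangular:
  fixes B :: "complex mat"
  assumes "B \<in> carrier_mat n n" "upper_triangular B"
  shows "proots (char_poly B) = mset (diag_mat B)"
proof -
  have *: "proots (\<Prod>a\<leftarrow>as. [:- a, 1:]) = mset as" for as :: "complex list"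
  proof (induction as)
    case (Cons a as)
    have "(\<Prod>a\<leftarrow>as. [:- a, 1:]) \<noteq> 0"
      by (auto simp: prod_list_zero_iff)
    then show ?case using Cons by (simp add: proots_mult del: mult_pCons_left)
  qed simp
  show ?thesis
    unfolding char_poly_upper_triangular[OF assms] by (rule *)
qed

text \<open>
  Scaling a triangular matrix scales its diagonal. This form includes \<open>c = 0\<close>, where it says that
  the zero matrix has \<open>n\<close> zero eigenvalues.
\<close>
lemma proots_char_poly_smult:
  fixes A :: "complex mat"
  assumes A: "A \<in> carrier_mat n n"
  shows "proots (char_poly (c \<cdot>\<^sub>m A)) = image_mset ((*) c) (proots (char_poly A))"
proof -
  obtain B where B: "B \<in> carrier_mat n n" "upper_triangular B" "similar_mat A B"
    using triangularization_complex[OF A] .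
  have "upper_triangular (c \<cdot>\<^sub>m B)"
    using B(1,2) by (auto simp: upper_triangular_def)
  moreover have "diag_mat (c \<cdot>\<^sub>m B) = map ((*) c) (diag_mat B)"
    using B(1) by (auto simp: diag_mat_def)
  ultimately have "proots (char_poly (c \<cdot>\<^sub>m B)) = image_mset ((*) c) (proots (char_poly B))"
    using B by (simp add: proots_char_poly_upper_triangular[of _ n])
  then show ?thesis
    using char_poly_similar[OF B(3)] char_poly_similar[OF similar_mat_smult[OF B(3), of c]]
    by simp
qed

lemma sum_diag_mult_comm:
  fixes P Q :: "'a :: comm_semiring_0 mat"
  assumes "P \<in> carrier_mat n m" "Q \<in> carrier_mat m n"
  shows "(\<Sum>i<n. (P * Q) $$ (i, i)) = (\<Sum>i<m. (Q * P) $$ (i, i))"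
proof -
  have "(\<Sum>i<n. (P * Q) $$ (i, i)) = (\<Sum>i<n. \<Sum>k<m. P $$ (i, k) * Q $$ (k, i))"
    using assms by (intro sum.cong) (auto simp: scalar_prod_def atLeast0LessThan)
  also have "\<dots> = (\<Sum>k<m. \<Sum>i<n. Q $$ (k, i) * P $$ (i, k))"
    by (subst sum.swap) (simp add: mult.commute)
  also have "\<dots> = (\<Sum>i<m. (Q * P) $$ (i, i))"
    using assms by (intro sum.cong) (auto simp: scalar_prod_def atLeast0LessThan)
  finally show ?thesis .
qed

text \<open>
  The trace is invariant under similarity, and the diagonal of the square of a triangular matrix
  consists of the squares of its diagonal entries.
\<close>
lemma sum_squares_eigenvalues:
  fixes A :: "complex mat"
  assumes A: "A \<in> carrier_mat n n"
  shows "(\<Sum>e\<in>#proots (char_poly A). e\<^sup>2) = (\<Sum>i<n. (A * A) $$ (i, i))"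
proof -
  obtain B where B: "B \<in> carrier_mat n n" "upper_triangular B" "similar_mat A B"
    using triangularization_complex[OF A] .
  obtain P Q where wit: "similar_mat_wit A B P Q"
    using B(3) unfolding similar_mat_def by blast
  note PQ = similar_mat_witD2[OF A wit]
  have "A * A = (P * B * Q) * (P * (B * Q))"
    using PQ by (metis assoc_mult_mat)
  also have "\<dots> = P * (B * ((Q * P) * (B * Q)))"
    using PQ(4-7) by (simp add: assoc_mult_mat[of _ n n _ n _ n])
  also have "\<dots> = P * (B * B * Q)"
    using PQ(4-7) unfolding PQ(2) by (simp add: assoc_mult_mat[of _ n n _ n _ n])
  finally have "(\<Sum>i<n. (A * A) $$ (i, i)) = (\<Sum>i<n. (B * B * Q * P) $$ (i, i))"
    using PQ(5-7) sum_diag_mult_comm[of P n n "B * B * Q"] by (metis mult_carrier_mat)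
  also have "B * B * Q * P = B * B * (Q * P)"
    using PQ(5-7) by (intro assoc_mult_mat) auto
  also have "\<dots> = B * B"
    using PQ(2,5) by simp
  also have "(\<Sum>i<n. (B * B) $$ (i, i)) = (\<Sum>i<n. (B $$ (i, i))\<^sup>2)"
  proof (rule sum.cong[OF refl])
    fix i assume "i \<in> {..<n}"
    then have i: "i < n" by simp
    \<comment> \<open>Of \<open>(i, k)\<close> and \<open>(k, i)\<close> with \<open>k \<noteq> i\<close>, one position lies below the diagonal.\<close>
    have "B $$ (i, k) * B $$ (k, i) = (if k = i then (B $$ (i, i))\<^sup>2 else 0)" if "k < n" for k
      using that i B(1) upper_triangularD[OF B(2), of k i] upper_triangularD[OF B(2), of i k]
      by (cases k i rule: linorder_cases) (auto simp: power2_eq_square)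
    then have "(\<Sum>k<n. B $$ (i, k) * B $$ (k, i)) = (B $$ (i, i))\<^sup>2"
      using i by simp
    then show "(B * B) $$ (i, i) = (B $$ (i, i))\<^sup>2"
      using i B(1) by (simp add: scalar_prod_def atLeast0LessThan)
  qed
  also have "\<dots> = (\<Sum>e\<in>#proots (char_poly B). e\<^sup>2)"
    using B(1) by (simp add: proots_char_poly_upper_triangular[OF B(1,2)] diag_mat_def
        sum_mset_sum_list o_def sum_list_distinct_conv_sum_set atLeast0LessThan
        flip: mset_map)
  finally show ?thesis
    using char_poly_similar[OF B(3)] by simp
qed

text \<open>
  Let \<open>M\<close> be the matrix with blocks \<open>S, T, T, S\<close>, and let \<open>P\<close> have the blocks \<open>1, 0, 1, 1\<close> and
  \<open>Q\<close> be its inverse. In \<open>Q M P\<close> the second block column of \<open>M\<close> is added to the first and then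
  the first block row is subtracted from the second. The result is block triangular, which is
  enough for the characteristic polynomial.
\<close>
lemma char_poly_symmetric_blocks:
  fixes S T :: "complex mat"
  assumes S: "S \<in> carrier_mat n n" and T: "T \<in> carrier_mat n n"
  shows "char_poly (four_block_mat S T T S) = char_poly (S + T) * char_poly (S - T)"
proof -
  let ?M = "four_block_mat S T T S"
  let ?N = "four_block_mat (S + T) T (0\<^sub>m n n) (S - T)"
  let ?P = "four_block_mat (1\<^sub>m n) (0\<^sub>m n n) (1\<^sub>m n) (1\<^sub>m n) :: complex mat"
  let ?Q = "four_block_mat (1\<^sub>m n) (0\<^sub>m n n) (- 1\<^sub>m n) (1\<^sub>m n) :: complex mat"
  have PQ: "?P * ?Q = 1\<^sub>m (n + n)"
    by (subst mult_four_block_mat[where ?n1.0 = n and ?n2.0 = n]) (auto intro!: eq_matI)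
  have QP: "?Q * ?P = 1\<^sub>m (n + n)"
    by (subst mult_four_block_mat[where ?n1.0 = n and ?n2.0 = n]) (auto intro!: eq_matI)
  have "?P * ?N = four_block_mat (S + T) T (S + T) S"
    using S T by (subst mult_four_block_mat[where ?n1.0 = n and ?n2.0 = n]) auto
  moreover have "four_block_mat (S + T) T (S + T) S * ?Q = ?M"
  proof -
    have "(S + T) + - T = S" "(S + T) + - S = T"
      using S T by auto
    then show ?thesis
      using S T by (subst mult_four_block_mat[where ?n1.0 = n and ?n2.0 = n]) auto
  qed
  ultimately have "?M = ?P * ?N * ?Q" by simp
  then have "similar_mat ?M ?N"
    using S T by (intro similar_matI[OF _ PQ QP]) auto
  then have "char_poly ?M = char_poly ?N" by (rule char_poly_similar)
  also have "\<dots> = char_poly (S + T) * char_poly (S - T)"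
  proof (rule char_poly_0_block[OF refl])
    show "\<exists>es. char_poly (S + T) = (\<Prod>a\<leftarrow>es. [:- a, 1:])"
      using char_poly_factorized[OF add_carrier_mat[OF T, of S]] by auto
    show "\<exists>es. char_poly (S - T) = (\<Prod>a\<leftarrow>es. [:- a, 1:])"
      using char_poly_factorized[OF minus_carrier_mat[OF T, of S]] by auto
  qed (use S T in auto)
  finally show ?thesis .
qed

text \<open>An element of largest modulus would have to be outdone by one of twice its modulus.\<close>
lemma zero_of_doubling_modulus:
  fixes M :: "complex multiset"
  assumes dbl: "\<And>e. e \<in># M \<Longrightarrow> \<exists>f\<in>#M. cmod f = 2 * cmod e" and e: "e \<in># M"
  shows "e = 0"
proof -
  let ?m = "Max (cmod ` set_mset M)"
  have le: "cmod f \<le> ?m" if "f \<in># M" for f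
    using that by simp
  have "?m \<in> cmod ` set_mset M"
    using e by (intro Max_in) auto
  then obtain m where m: "m \<in># M" "cmod m = ?m" by auto
  obtain f where "f \<in># M" "cmod f = 2 * cmod m" using dbl[OF m(1)] by blast
  then have "?m \<le> 0" using le[of f] m(2) by simp
  then have "cmod e \<le> 0" using le[OF e] by linarith
  then show ?thesis by simp
qed

section \<open>Spectra of graphs built from two copies of a graph\<close>

lemma ex_vertex_enumeration:
  assumes "pair_graph G"
  obtains vs where "vertex_enumeration G vs"
proof -
  interpret pair_graph G by fact
  show thesis
    using that finite_distinct_list[OF pair_finite_verts] by (auto simp: vertex_enumeration_def)
qed

text \<open>
  The diagonal entry of \<open>A\<^sup>2\<close> at a vertex counts the closed walks of length two from it, which
  correspond to the arcs leaving it.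
\<close>
lemma sum_squares_A_spectrum:
  assumes "pair_graph G"
  shows "(\<Sum>e\<in>#A_spectrum G. e\<^sup>2) = of_nat (card (parcs G))"
proof -
  interpret pair_graph G by fact
  obtain vs where vs: "vertex_enumeration G vs" using ex_vertex_enumeration[OF assms] .
  define n where "n = length vs"
  let ?A = "adjacency_matrix G vs"
  have A: "?A \<in> carrier_mat n n" by (simp add: adjacency_matrix_def n_def)
  have bij: "bij_betw ((!) vs) {..<n} (pverts G)"
    using vs by (auto simp: vertex_enumeration_def n_def intro: bij_betw_nth)
  have sym: "(u, v) \<in> parcs G \<longleftrightarrow> (v, u) \<in> parcs G" for u v
    using sym_arcs by (auto simp: symmetric_def sym_def)
  have reindex: "(\<Sum>i<n. f (vs ! i)) = (\<Sum>u\<in>pverts G. f u)" for f :: "'a \<Rightarrow> complex"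
    by (rule sum.reindex_bij_betw[OF bij])
  have "(\<Sum>e\<in>#A_spectrum G. e\<^sup>2) = (\<Sum>i<n. (?A * ?A) $$ (i, i))"
    by (simp add: A_spectrum_eq[OF vs] sum_squares_eigenvalues[OF A])
  also have "\<dots> = (\<Sum>i<n. \<Sum>k<n. of_bool ((vs ! i, vs ! k) \<in> parcs G))"
  proof (intro sum.cong refl)
    fix i assume "i \<in> {..<n}"
    then have "(?A * ?A) $$ (i, i) = (\<Sum>k<n. ?A $$ (i, k) * ?A $$ (k, i))"
      using A by (simp add: scalar_prod_def atLeast0LessThan)
    also have "\<dots> = (\<Sum>k<n. of_bool ((vs ! i, vs ! k) \<in> parcs G))"
      using \<open>i \<in> {..<n}\<close>
      by (intro sum.cong refl) (auto simp: adjacency_matrix_def n_def sym[of "vs ! _" "vs ! i"])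
    finally show "(?A * ?A) $$ (i, i) = (\<Sum>k<n. of_bool ((vs ! i, vs ! k) \<in> parcs G))" .
  qed
  also have "\<dots> = (\<Sum>u\<in>pverts G. \<Sum>v\<in>pverts G. of_bool ((u, v) \<in> parcs G))"
    by (simp only: reindex[of "\<lambda>v. of_bool ((_, v) \<in> parcs G)"]
        reindex[of "\<lambda>u. \<Sum>v\<in>pverts G. of_bool ((u, v) \<in> parcs G)"])
  also have "\<dots> = (\<Sum>e\<in>pverts G \<times> pverts G. of_bool (e \<in> parcs G))"
    by (simp only: sum.cartesian_product case_prod_unfold prod.collapse)
  also have "\<dots> = of_nat (card ((pverts G \<times> pverts G) \<inter> parcs G))"
    by (simp add: sum_of_bool_eq pair_finite_verts Int_def)
  also have "(pverts G \<times> pverts G) \<inter> parcs G = parcs G"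
    by (auto dest: in_arcsD1 in_arcsD2)
  finally show ?thesis .
qed

text \<open>
  This treats both constructions at once: every edge of \<open>G\<close> always joins different layers, and it
  occurs inside the layers, too, precisely if \<open>p\<close> holds. The blocks are then \<open>S = pA\<close> and
  \<open>T = A\<close>, with \<open>p\<close> read as \<open>0\<close> or \<open>1\<close>.
\<close>
lemma A_spectrum_two_layers:
  fixes G :: "'a pair_pre_digraph" and H :: "('a \<times> 'b) pair_pre_digraph"
  assumes G: "pair_graph G"
    and verts: "pverts H = pverts G \<times> {a, b}" and ab: "a \<noteq> b"
    and arcs: "\<And>u v x y. x \<in> {a, b} \<Longrightarrow> y \<in> {a, b} \<Longrightarrow>
      ((u, x), (v, y)) \<in> parcs H \<longleftrightarrow> (u, v) \<in> parcs G \<and> (p \<or> x \<noteq> y)"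
  shows "A_spectrum H = image_mset ((*) (of_bool p + 1)) (A_spectrum G)
    + image_mset ((*) (of_bool p - 1)) (A_spectrum G)"
proof -
  obtain vs where vs: "vertex_enumeration G vs" using ex_vertex_enumeration[OF G] .
  define n where "n = length vs"
  define ws where "ws = map (\<lambda>v. (v, a)) vs @ map (\<lambda>v. (v, b)) vs"
  let ?A = "adjacency_matrix G vs" and ?p = "of_bool p :: complex"
  have A: "?A \<in> carrier_mat n n" by (simp add: adjacency_matrix_def n_def)
  have ws: "vertex_enumeration H ws"
    using vs ab unfolding vertex_enumeration_def ws_def verts
    by (auto simp: distinct_map inj_on_def)
  have "adjacency_matrix H ws = four_block_mat (?p \<cdot>\<^sub>m ?A) ?A ?A (?p \<cdot>\<^sub>m ?A)"
    using ab by (intro eq_matI) (auto simp: adjacency_matrix_def ws_def nth_append arcs)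
  then have "char_poly (adjacency_matrix H ws)
      = char_poly (?p \<cdot>\<^sub>m ?A + ?A) * char_poly (?p \<cdot>\<^sub>m ?A - ?A)"
    using char_poly_symmetric_blocks[OF smult_carrier_mat[OF A] A] by simp
  also have "?p \<cdot>\<^sub>m ?A + ?A = (?p + 1) \<cdot>\<^sub>m ?A"
    using A by (intro eq_matI) (auto simp: algebra_simps)
  also have "?p \<cdot>\<^sub>m ?A - ?A = (?p - 1) \<cdot>\<^sub>m ?A"
    using A by (intro eq_matI) (auto simp: algebra_simps)
  finally have cp: "char_poly (adjacency_matrix H ws)
      = char_poly ((?p + 1) \<cdot>\<^sub>m ?A) * char_poly ((?p - 1) \<cdot>\<^sub>m ?A)" .
  have "char_poly (c \<cdot>\<^sub>m ?A) \<noteq> 0" for c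
    using degree_monic_char_poly[OF smult_carrier_mat[OF A, of c]] by auto
  then show ?thesis
    by (simp add: A_spectrum_eq[OF ws] A_spectrum_eq[OF vs] cp proots_mult
        proots_char_poly_smult[OF A])
qed

lemma A_spectrum_double_graph:
  assumes "pair_graph G"
  shows "A_spectrum (double_graph G)
    = image_mset ((*) 2) (A_spectrum G) + image_mset (\<lambda>_. 0) (A_spectrum G)"
proof -
  have "A_spectrum (double_graph G) = image_mset ((*) (of_bool True + 1)) (A_spectrum G)
      + image_mset ((*) (of_bool True - 1)) (A_spectrum G)"
    using assms by (rule A_spectrum_two_layers[where a = 1 and b = 2])
      (auto simp: double_graph_def)
  moreover have "(*) 0 = (\<lambda>_. 0 :: complex)" by auto
  ultimately show ?thesis by simp
qed

lemma A_spectrum_kronecker_product_K2: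
  assumes "pair_graph G" "complete_digraph 2 (with_proj K2)"
  shows "A_spectrum (kronecker_product G K2)
    = A_spectrum G + image_mset uminus (A_spectrum G)"
proof -
  obtain a b where ab: "a \<noteq> b" "pverts K2 = {a, b}"
    using assms(2) by (auto simp: complete_digraph_pair_def card_2_iff)
  then have "parcs K2 = {(x, y). x \<in> {a, b} \<and> y \<in> {a, b} \<and> x \<noteq> y}"
    using assms(2) by (auto simp: complete_digraph_pair_def)
  then have "A_spectrum (kronecker_product G K2)
      = image_mset ((*) (of_bool False + 1)) (A_spectrum G)
      + image_mset ((*) (of_bool False - 1)) (A_spectrum G)"
    using ab by (intro A_spectrum_two_layers[OF assms(1) _ ab(1)])
      (auto simp: kronecker_product_def)
  moreover have "(*) 1 = (\<lambda>e. e :: complex)" "(*) (- 1) = (uminus :: complex \<Rightarrow> complex)"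
    by auto
  ultimately show ?thesis by simp
qed

section \<open>Comparison of the two spectra\<close>

theorem theorem2p6:
  fixes G :: "'a pair_pre_digraph" and K2 :: "'b pair_pre_digraph"
  assumes "pair_graph G"
    and "complete_digraph 2 (with_proj K2)"
  shows "equienergetic (kronecker_product G K2) (double_graph G)
    \<and> (parcs G \<noteq> {} \<longrightarrow> non_cospectral (kronecker_product G K2) (double_graph G))"
proof (intro conjI impI)
  note spec = A_spectrum_kronecker_product_K2[OF assms] A_spectrum_double_graph[OF assms(1)]
  have "energy (kronecker_product G K2) = 2 * energy G"
    by (simp add: energy_def spec image_mset.compositionality o_def)
  moreover have "energy (double_graph G) = 2 * energy G"
    by (simp add: energy_def spec image_mset.compositionality o_def norm_mult
        sum_mset_distrib_left)
  moreover have "card (pverts (kronecker_product G K2)) = card (pverts (double_graph G))"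
    using assms(2) by (simp add: kronecker_product_def double_graph_def
        complete_digraph_pair_def card_cartesian_product)
  ultimately show "equienergetic (kronecker_product G K2) (double_graph G)"
    by (simp add: equienergetic_def)
next
  assume edge: "parcs G \<noteq> {}"
  interpret pair_graph G by fact
  show "non_cospectral (kronecker_product G K2) (double_graph G)"
    unfolding non_cospectral_def
  proof
    assume eq: "A_spectrum (kronecker_product G K2) = A_spectrum (double_graph G)"
    have "\<exists>f\<in>#A_spectrum G. cmod f = 2 * cmod e" if "e \<in># A_spectrum G" for e
    proof -
      have "2 * e \<in># A_spectrum (double_graph G)"
        using that by (simp add: A_spectrum_double_graph[OF assms(1)])
      then have "2 * e \<in># A_spectrum G + image_mset uminus (A_spectrum G)"
        unfolding eq[symmetric] A_spectrum_kronecker_product_K2[OF assms] .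
      then obtain f where "f \<in># A_spectrum G" "2 * e = f \<or> 2 * e = - f" by auto
      moreover from this(2) have "cmod f = cmod (2 * e)" by (metis norm_minus_cancel)
      ultimately show ?thesis by (metis norm_mult norm_numeral)
    qed
    then have "e = 0" if "e \<in># A_spectrum G" for e
      using zero_of_doubling_modulus that by blast
    then have "(\<Sum>e\<in>#A_spectrum G. e\<^sup>2) = 0"
      by (intro sum_mset.neutral) auto
    then have "card (parcs G) = 0"
      by (simp add: sum_squares_A_spectrum[OF assms(1)])
    then show False
      using edge pair_finite_arcs by simp
  qed
qed

end
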